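(* Let $p>2$ be a prime and let $\tau\ge 1$ be a fixed integer. Let the $p^{\tau+1}$-periodic binary sequence $\widetilde{\mathbf{s}}=(\widetilde{s}_0,\widetilde{s}_1,\ldots,\widetilde{s}_{p^{\tau+1}-1})$ be defined by $$\widetilde{s}_t=\begin{cases}0, & \text{if } 0\le \dfrac{Q_{p^\tau}(t)}{p^\tau}<\dfrac12,\\[2mm] 1, & \text{if } \dfrac12\le \dfrac{Q_{p^\tau}(t)}{p^\tau}<1,\end{cases}$$ where $Q_{p^\tau}$ is the Euler quotient modulo $p^\tau$. Then $$\sum_{t=0}^{p^{\tau+1}-1}(-1)^{\widetilde{s}_t+\widetilde{s}_{t+p^\tau}+\widetilde{s}_{t+2p^\tau}+\widetilde{s}_{t+3p^\tau}}=\frac13\,p^{\tau+1}+O\left(p^{\tau+\frac12}(\log p^\tau)^4\right).$$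
   Context: $\phi$ is Euler's totient function. For an odd integer $m\ge 2$ and an integer $n$ with $\gcd(n,m)=1$, the Euler quotient $Q_m(n)$ is the unique integer with $0\le Q_m(n)<m$ and $Q_m(n)\equiv \frac{n^{\phi(m)}-1}{m}\pmod m$; if $\gcd(n,m)>1$, then $Q_m(n)=0$. Here $m=p^\tau$. The indices of the sequence are extended periodically with period $p^{\tau+1}$. *)

theory Defs
  imports Complex_Main "HOL-Number_Theory.Number_Theory"
begin

definition euler_quotient :: "nat \<Rightarrow> int \<Rightarrow> int" where
  "euler_quotient m n =
     (if coprime n (int m) then ((n ^ totient m - 1) div int m) mod int m else 0)"

(* The div above is exact. *)
lemma euler_quotient_dvd:
  assumes "coprime n (int m)" "m > 0"
  shows "int m dvd n ^ totient m - 1"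
proof -
  define k where "k = nat (n mod int m)"
  have k: "int k = n mod int m"
    using assms(2) by (simp add: k_def)
  have "coprime (int k) (int m)"
    using assms by (simp add: k coprime_mod_left_iff)
  then have "[k ^ totient m = 1] (mod m)"
    by (intro euler_theorem) simp
  then have "[int k ^ totient m = 1] (mod int m)"
    by (metis cong_int_iff of_nat_1 of_nat_power)
  moreover have "[n ^ totient m = int k ^ totient m] (mod int m)"
    by (intro cong_pow) (simp add: k)
  ultimately show ?thesis
    by (metis cong_iff_dvd_diff cong_trans)
qed

lemma euler_quotient_unique:
  assumes "coprime n (int m)" "m > 0"
  shows "q = euler_quotient m n \<longleftrightarrow>
           0 \<le> q \<and> q < int m \<and> [q = (n ^ totient m - 1) div int m] (mod int m)"
  using assms by (auto simp: euler_quotient_def cong_def)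

(* Reducing t modulo p^(tau+1) is the periodic extension of the indices. *)
definition euler_binary_seq :: "nat \<Rightarrow> nat \<Rightarrow> nat \<Rightarrow> nat" where
  "euler_binary_seq p \<tau> t =
     (let x = real_of_int (euler_quotient (p ^ \<tau>) (int (t mod p ^ (\<tau> + 1)))) / real (p ^ \<tau>)
      in if 0 \<le> x \<and> x < 1 / 2 then 0 else 1)"

(* The value 1 is attained exactly when 1/2 <= x < 1. *)
lemma euler_quotient_range:
  assumes "m > 0"
  shows "0 \<le> euler_quotient m n" "euler_quotient m n < int m"
  using assms by (auto simp: euler_quotient_def)

end

theory Submission
  imports Defs
begin

text \<open>
  Write \<open>m = p^\<tau>\<close> and \<open>N = p^(\<tau>-1)\<close>. The sum can be evaluated exactly, because the four terms of
  the sequence at \<open>t, t+m, t+2m, t+3m\<close> depend on \<open>t\<close> only through two residues modulo \<open>p\<close>, and these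
  two residues are perfectly equidistributed.

  Since \<open>m\<close> is odd, \<open>Q < m/2\<close> holds exactly when the residue of \<open>2Q\<close> modulo \<open>m\<close> is even, so the
  sign attached to an index is the parity of \<open>2Q mod m\<close>. By the binomial theorem modulo \<open>m^2\<close>,
  \<open>2Q(t+km) \<equiv> 2Q(t) + kdN\<close> modulo \<open>m\<close>, where \<open>d \<equiv> -2/t\<close> modulo \<open>p\<close>: passing from \<open>t\<close> to \<open>t+m\<close> adds
  \<open>d\<close> to the leading base-\<open>p\<close> digit \<open>w\<close> of \<open>2Q mod m\<close> and leaves the other digits alone
  (\<open>leading_digit_shift\<close>). In the product of the four signs the residue \<open>2Q(t) mod m\<close> is counted four
  times and \<open>d\<close> is counted \<open>0+1+2+3 = 6\<close> times, so both cancel modulo 2, and only the parity of the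
  number of carries \<open>\<lfloor>(w+kd)/p\<rfloor>\<close> for \<open>k = 1, 2, 3\<close> survives (\<open>shift_pattern_sign_eq_carry_sign\<close>).

  When \<open>t\<close> runs through a coset \<open>u + m\<int>\<close> with \<open>p\<close> not dividing \<open>u\<close>, the step \<open>d\<close> is fixed and
  nonzero and \<open>w\<close> takes every value modulo \<open>p\<close> once. When \<open>u\<close> varies, \<open>d\<close> takes every
  nonzero value equally often. The multiples of \<open>p\<close> have sign 1 and account for \<open>d = 0\<close>.
  Hence the sum is \<open>N\<close> times the sum of the carry signs over the
  square \<open>0 \<le> w, d < p\<close>. For fixed \<open>d\<close> the sign alternates between consecutive carry thresholds,
  which makes the row sum a piecewise linear function of \<open>d\<close> (\<open>sum_carry_sign_row\<close>); the total
  over the square is \<open>(p^2+2)/3\<close> for \<open>p > 3\<close> and 1 for \<open>p = 3\<close> (\<open>sum_carry_sign_square\<close>). The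
  difference to the main term \<open>p^(\<tau>+1)/3\<close> is therefore at most \<open>2 p^(\<tau>-1)\<close>.
\<close>

section \<open>Counting carries along four-term progressions\<close>

text \<open>
  For \<open>0 \<le> w < p\<close> the quotient \<open>(w + k d) div p\<close> is the carry out of the digit \<open>w\<close> when \<open>d\<close> is
  added to it \<open>k\<close> times.
\<close>

definition carry_sign :: "int \<Rightarrow> int \<Rightarrow> int \<Rightarrow> int" where
  "carry_sign p w d =
     (if even ((w + d) div p + (w + 2 * d) div p + (w + 3 * d) div p) then 1 else -1)"

lemma div_eqI_int:
  fixes x p q :: int
  assumes "q * p \<le> x" "x < (q + 1) * p"
  shows "x div p = q"
proof -
  have "p > 0" using assms by (simp add: algebra_simps)
  then show ?thesis
    using assms by (intro int_div_pos_eq[where r = "x - q * p"]) (auto simp: algebra_simps)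
qed

lemma sum_int_interval_split:
  fixes a b c :: int
  assumes "a \<le> b" "b \<le> c"
  shows "sum f {a..<c} = sum f {a..<b} + sum f {b..<c}"
proof -
  have "{a..<c} = {a..<b} \<union> {b..<c}" using assms by auto
  then show ?thesis by (simp add: sum.union_disjoint)
qed

text \<open>
  Each carry increases by one at a threshold in \<open>w\<close>, so for fixed \<open>d\<close> the carry sign flips at three
  thresholds in \<open>0..p\<close>; only their positions and the initial sign matter for the sum.
\<close>

lemma sum_alternating_steps:
  fixes x y z p e :: int
  assumes "0 \<le> x" "x \<le> y" "y \<le> z" "z \<le> p"
    and "\<And>w. 0 \<le> w \<Longrightarrow> w < x \<Longrightarrow> f w = e"
    and "\<And>w. x \<le> w \<Longrightarrow> w < y \<Longrightarrow> f w = -e"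
    and "\<And>w. y \<le> w \<Longrightarrow> w < z \<Longrightarrow> f w = e"
    and "\<And>w. z \<le> w \<Longrightarrow> w < p \<Longrightarrow> f w = -e"
  shows "sum f {0..<p} = e * (2 * x - 2 * y + 2 * z - p)"
proof -
  have const: "sum f {a..<b} = (b - a) * c" if "a \<le> b" "\<And>w. a \<le> w \<Longrightarrow> w < b \<Longrightarrow> f w = c"
    for a b c :: int
  proof -
    have "sum f {a..<b} = sum (\<lambda>_. c) {a..<b}" using that by (intro sum.cong) auto
    then show ?thesis using that(1) by simp
  qed
  have "sum f {0..<p} = sum f {0..<x} + (sum f {x..<y} + (sum f {y..<z} + sum f {z..<p}))"
    using assms(1-4) by (simp add: sum_int_interval_split[of 0 x p] sum_int_interval_split[of x y p]
        sum_int_interval_split[of y z p])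
  also have "\<dots> = (x - 0) * e + ((y - x) * -e + ((z - y) * e + (p - z) * -e))"
    using assms by (subst (1 2 3 4) const) auto
  finally show ?thesis by (simp add: algebra_simps)
qed

lemma carry_sign_eq:
  assumes "i * p \<le> w + d" "w + d < (i + 1) * p"
    and "j * p \<le> w + 2 * d" "w + 2 * d < (j + 1) * p"
    and "k * p \<le> w + 3 * d" "w + 3 * d < (k + 1) * p"
  shows "carry_sign p w d = (if even (i + j + k) then 1 else -1)"
  using assms by (simp add: carry_sign_def div_eqI_int)

text \<open>
  For \<open>d > 0\<close> the thresholds in \<open>w\<close> are the residues of \<open>-d, -2d, -3d\<close> modulo \<open>p\<close>. They move linearly with
  \<open>d\<close> until one of them wraps around or two of them cross, which happens at \<open>d = p/3, p/2, 2p/3\<close>.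
  Writing the resulting broken line with one truncation per kink gives a formula that can be
  summed over \<open>d\<close> term by term.
\<close>

lemma sum_carry_sign_row:
  assumes "0 \<le> d" "d < p"
  shows "(\<Sum>w\<in>{0..<p}. carry_sign p w d) =
    p - 4 * d + 4 * max 0 (3 * d - p) - 8 * max 0 (2 * d - p) + 4 * max 0 (3 * d - 2 * p)"
proof -
  consider "3 * d \<le> p" | "p < 3 * d" "2 * d \<le> p" | "p < 2 * d" "3 * d \<le> 2 * p" | "2 * p < 3 * d"
    by linarith
  then show ?thesis
  proof cases
    \<comment> \<open>In each case the thresholds are listed in increasing order, and the four instances of
        \<open>carry_sign_eq\<close> give the carries on the four intervals between them.\<close>
    case 1
    have "(\<Sum>w\<in>{0..<p}. carry_sign p w d)
        = 1 * (2 * (p - 3 * d) - 2 * (p - 2 * d) + 2 * (p - d) - p)"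
      using assms 1
      by (intro sum_alternating_steps)
        (simp_all add: carry_sign_eq[of 0 p _ d 0 0] carry_sign_eq[of 0 p _ d 0 1]
          carry_sign_eq[of 0 p _ d 1 1] carry_sign_eq[of 1 p _ d 1 1])
    then show ?thesis using assms 1 by simp
  next
    case 2
    have "(\<Sum>w\<in>{0..<p}. carry_sign p w d)
        = (-1) * (2 * (p - 2 * d) - 2 * (p - d) + 2 * (2 * p - 3 * d) - p)"
      using assms 2
      by (intro sum_alternating_steps)
        (simp_all add: carry_sign_eq[of 0 p _ d 0 1] carry_sign_eq[of 0 p _ d 1 1]
          carry_sign_eq[of 1 p _ d 1 1] carry_sign_eq[of 1 p _ d 1 2])
    then show ?thesis using assms 2 by simp
  next
    case 3
    have "(\<Sum>w\<in>{0..<p}. carry_sign p w d)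
        = 1 * (2 * (2 * p - 3 * d) - 2 * (p - d) + 2 * (2 * p - 2 * d) - p)"
      using assms 3
      by (intro sum_alternating_steps)
        (simp_all add: carry_sign_eq[of 0 p _ d 1 1] carry_sign_eq[of 0 p _ d 1 2]
          carry_sign_eq[of 1 p _ d 1 2] carry_sign_eq[of 1 p _ d 2 2])
    then show ?thesis using assms 3 by simp
  next
    case 4
    have "(\<Sum>w\<in>{0..<p}. carry_sign p w d)
        = (-1) * (2 * (p - d) - 2 * (2 * p - 2 * d) + 2 * (3 * p - 3 * d) - p)"
      using assms 4
      by (intro sum_alternating_steps)
        (simp_all add: carry_sign_eq[of 0 p _ d 1 2] carry_sign_eq[of 1 p _ d 1 2]
          carry_sign_eq[of 1 p _ d 2 2] carry_sign_eq[of 1 p _ d 2 3])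
    then show ?thesis using assms 4 by simp
  qed
qed

text \<open>
  Replacing \<open>n\<close> by \<open>n + 3\<close> shifts the progression by one index and adds the single term \<open>n\<close>,
  so the sum is quadratic in \<open>n\<close> up to a correction depending on \<open>n\<close> modulo 3.
\<close>

lemma sum_truncated_progression3:
  fixes n N :: nat
  assumes "n \<le> 3 * N"
  shows "6 * (\<Sum>e = 1..N. max 0 (int n - 3 * int e)) = int n * (int n - 3) + (if 3 dvd n then 0 else 2)"
  using assms
proof (induction N arbitrary: n)
  case 0
  then show ?case by simp
next
  case (Suc N)
  show ?case
  proof (cases "n < 3")
    case True
    have "(\<Sum>e = 1..Suc N. max 0 (int n - 3 * int e)) = (\<Sum>e = 1..Suc N. 0)"
      using True by (intro sum.cong) auto
    moreover have "n = 0 \<or> n = 1 \<or> n = 2" using True by auto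
    ultimately show ?thesis by auto
  next
    case False
    then obtain l where n: "n = l + 3" by (metis add.commute le_Suc_ex not_less)
    have "(\<Sum>e = 1..Suc N. max 0 (int n - 3 * int e))
        = max 0 (int n - 3) + (\<Sum>e = 1..N. max 0 (int n - 3 * int (Suc e)))"
      by (simp only: sum.atLeast_Suc_atMost[of 1 "Suc N"] sum.shift_bounds_cl_Suc_ivl)
    also have "\<dots> = int l + (\<Sum>e = 1..N. max 0 (int l - 3 * int e))"
      by (simp add: n)
    finally have "6 * (\<Sum>e = 1..Suc N. max 0 (int n - 3 * int e))
        = 6 * int l + (int l * (int l - 3) + (if 3 dvd l then 0 else 2))"
      using Suc.IH[of l] Suc.prems n by simp
    moreover have "3 dvd n \<longleftrightarrow> 3 dvd l" unfolding n by presburger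
    ultimately show ?thesis by (simp add: n algebra_simps)
  qed
qed

lemma sum_truncated_progression2:
  fixes h N :: nat
  assumes "h \<le> N"
  shows "(\<Sum>e = 1..N. max 0 (2 * int h + 1 - 2 * int e)) = int h ^ 2"
  using assms
proof (induction N arbitrary: h)
  case 0
  then show ?case by simp
next
  case (Suc N)
  show ?case
  proof (cases h)
    case 0
    then show ?thesis by (auto intro!: sum.neutral)
  next
    case (Suc l)
    have "(\<Sum>e = 1..Suc N. max 0 (2 * int h + 1 - 2 * int e))
        = max 0 (2 * int h - 1) + (\<Sum>e = 1..N. max 0 (2 * int h + 1 - 2 * int (Suc e)))"
      by (simp only: sum.atLeast_Suc_atMost[of 1 "Suc N"] sum.shift_bounds_cl_Suc_ivl)
    also have "\<dots> = 2 * int l + 1 + (\<Sum>e = 1..N. max 0 (2 * int l + 1 - 2 * int e))"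
      by (simp add: Suc algebra_simps)
    finally show ?thesis
      using Suc.IH[of l] Suc.prems by (simp add: \<open>h = Suc l\<close> power2_eq_square algebra_simps)
  qed
qed

lemma sum_carry_sign_square:
  assumes "odd (p :: nat)"
  shows "3 * (\<Sum>d\<in>{0..<int p}. \<Sum>w\<in>{0..<int p}. carry_sign (int p) w d)
    = int p ^ 2 + (if 3 dvd p then -6 else 2)"
proof -
  obtain h where p: "p = 2 * h + 1" using assms oddE by blast
  have lin: "2 * (\<Sum>e = Suc 0..n. int e) = int n * (int n + 1)" for n :: nat
    by (induction n) (auto simp: algebra_simps)
  have "(\<Sum>d\<in>{0..<int p}. \<Sum>w\<in>{0..<int p}. carry_sign (int p) w d)
     = (\<Sum>d\<in>{0..<int p}. int p - 4 * d + 4 * max 0 (3 * d - int p) - 8 * max 0 (2 * d - int p)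
          + 4 * max 0 (3 * d - 2 * int p))"
    by (intro sum.cong refl sum_carry_sign_row) auto
  \<comment> \<open>The substitution \<open>d = p - e\<close> turns every truncated term into a decreasing progression in \<open>e\<close>.\<close>
  also have "\<dots> = (\<Sum>e = 1..p. 4 * int e - 3 * int p + 4 * max 0 (int (2 * p) - 3 * int e)
          - 8 * max 0 (2 * int h + 1 - 2 * int e) + 4 * max 0 (int p - 3 * int e))"
    by (rule sum.reindex_bij_witness[where i = "\<lambda>e. int p - int e" and j = "\<lambda>d. nat (int p - d)"])
      (auto simp: p algebra_simps)
  also have "\<dots> = 2 * int p * (int p + 1) - 3 * int p * int p
        + 4 * (\<Sum>e = 1..p. max 0 (int (2 * p) - 3 * int e))
        - 8 * (\<Sum>e = 1..p. max 0 (2 * int h + 1 - 2 * int e))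
        + 4 * (\<Sum>e = 1..p. max 0 (int p - 3 * int e))"
    by (simp only: sum.distrib sum_subtractf sum_distrib_left [symmetric])
      (simp add: lin)
  finally have "3 * (\<Sum>d\<in>{0..<int p}. \<Sum>w\<in>{0..<int p}. carry_sign (int p) w d)
      = 6 * int p * (int p + 1) - 9 * int p * int p
        + 2 * (6 * (\<Sum>e = 1..p. max 0 (int (2 * p) - 3 * int e)))
        - 24 * (\<Sum>e = 1..p. max 0 (2 * int h + 1 - 2 * int e))
        + 2 * (6 * (\<Sum>e = 1..p. max 0 (int p - 3 * int e)))"
    by (simp add: algebra_simps)
  also have "\<dots> = 6 * int p * (int p + 1) - 9 * int p * int p
        + 2 * (int (2 * p) * (int (2 * p) - 3) + (if 3 dvd 2 * p then 0 else 2))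
        - 24 * int h ^ 2
        + 2 * (int p * (int p - 3) + (if 3 dvd p then 0 else 2))"
    by (subst (1 2) sum_truncated_progression3, simp, simp, subst sum_truncated_progression2)
      (auto simp: p)
  also have "3 dvd 2 * p \<longleftrightarrow> 3 dvd p" by presburger
  finally have "3 * (\<Sum>d\<in>{0..<int p}. \<Sum>w\<in>{0..<int p}. carry_sign (int p) w d)
      = 6 * int p * (int p + 1) - 9 * int p * int p
        + 2 * (int (2 * p) * (int (2 * p) - 3) + (if 3 dvd p then 0 else 2))
        - 24 * int h ^ 2
        + 2 * (int p * (int p - 3) + (if 3 dvd p then 0 else 2))" .
  moreover have "int p = 2 * int h + 1" by (simp add: p)
  ultimately show ?thesis
    by (cases "3 dvd p") (simp_all add: power2_eq_square algebra_simps)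
qed

section \<open>Shifting the argument of an Euler quotient\<close>

lemma power_add_second_order:
  fixes x y :: int
  shows "y ^ 2 dvd (x + y) ^ Suc j - x ^ Suc j - int (Suc j) * y * x ^ j"
proof (induction j)
  case (Suc j)
  have "(x + y) ^ Suc (Suc j) - x ^ Suc (Suc j) - int (Suc (Suc j)) * y * x ^ Suc j
    = (x + y) * ((x + y) ^ Suc j - x ^ Suc j - int (Suc j) * y * x ^ j)
      + y ^ 2 * (int (Suc j) * x ^ j)"
    by (simp add: algebra_simps power2_eq_square)
  then show ?case using Suc by simp
qed simp

text \<open>
  Modulo \<open>m^2\<close> only the linear term of the binomial expansion of \<open>(n + k m)^\<phi>(m)\<close> survives, and
  dividing by \<open>m\<close> leaves a congruence modulo \<open>m\<close>.
\<close>

lemma euler_quotient_shift: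
  assumes "coprime n (int m)" "m > 0"
  shows "[euler_quotient m (n + k * int m)
    = euler_quotient m n + k * int (totient m) * n ^ (totient m - 1)] (mod int m)"
proof -
  define j where "j = totient m - 1"
  have j: "totient m = Suc j" using assms(2) by (simp add: j_def)
  define A where "A = (n ^ Suc j - 1) div int m"
  define B where "B = ((n + k * int m) ^ Suc j - 1) div int m"
  have cop: "coprime (n + k * int m) (int m)"
    using assms(1) by (metis add.commute coprime_iff_gcd_eq_1 gcd_add_mult gcd.commute)
  have A: "n ^ Suc j = 1 + int m * A"
    using euler_quotient_dvd[OF assms] by (simp add: A_def j)
  have B: "(n + k * int m) ^ Suc j = 1 + int m * B"
    using euler_quotient_dvd[OF cop assms(2)] by (simp add: B_def j)
  have "int m ^ 2 dvd (k * int m) ^ 2" by (simp add: power_mult_distrib)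
  then have "int m ^ 2 dvd (n + k * int m) ^ Suc j - n ^ Suc j - int (Suc j) * (k * int m) * n ^ j"
    using power_add_second_order dvd_trans by blast
  also have "(n + k * int m) ^ Suc j - n ^ Suc j - int (Suc j) * (k * int m) * n ^ j
      = int m * (B - (A + k * int (Suc j) * n ^ j))"
    unfolding A B by (simp add: algebra_simps)
  finally have "int m dvd B - (A + k * int (Suc j) * n ^ j)"
    using assms(2) by (simp add: power2_eq_square)
  then have "[B = A + k * int (Suc j) * n ^ j] (mod int m)"
    by (simp add: cong_iff_dvd_diff)
  then show ?thesis
    using assms(1) cop by (simp add: euler_quotient_def A_def B_def j cong_def mod_simps)
qed


text \<open>
  The modulus of the Euler quotient is \<open>p ^ Suc s\<close>, so that \<open>p ^ s\<close> is the place value of the top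
  base-\<open>p\<close> digit of a residue.
\<close>

definition leading_digit :: "nat \<Rightarrow> nat \<Rightarrow> int \<Rightarrow> int" where
  "leading_digit p s t = (2 * euler_quotient (p ^ Suc s) t) mod (int p ^ s * int p) div int p ^ s"

text \<open>
  For \<open>t\<close> prime to \<open>p\<close> this is the residue of \<open>-2 / t\<close> modulo \<open>p\<close>. For \<open>t\<close> divisible by an odd
  \<open>p\<close> it is 0, which lets the indices where the Euler quotient is 0 by convention be treated as the case of step 0.
\<close>

definition digit_step :: "nat \<Rightarrow> nat \<Rightarrow> int \<Rightarrow> int" where
  "digit_step p s t = (2 * (int p - 1) * t ^ (totient (p ^ Suc s) - 1)) mod int p"

lemma coprime_prime_power_iff:
  assumes "prime p"
  shows "coprime t (int (p ^ Suc s)) \<longleftrightarrow> \<not> int p dvd t"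
proof -
  have "prime (int p)" using assms by simp
  then have "coprime (int p) t \<longleftrightarrow> \<not> int p dvd t"
    by (metis coprime_absorb_left not_prime_unit prime_imp_coprime)
  then show ?thesis by (simp add: coprime_commute del: power_Suc)
qed

text \<open>
  As \<open>\<phi>(p^(s+1)) = p^s (p-1)\<close>, the correction term is a multiple of \<open>p^s\<close> and matters only through
  its cofactor modulo \<open>p\<close>.
\<close>

lemma double_quotient_shift:
  assumes "prime p" "\<not> int p dvd t"
  shows "[2 * euler_quotient (p ^ Suc s) (t + k * int (p ^ Suc s))
    = 2 * euler_quotient (p ^ Suc s) t + k * digit_step p s t * int p ^ s] (mod int p ^ s * int p)"
proof -
  define P where "P = t ^ (totient (p ^ Suc s) - 1)"
  have p: "p > 0" using assms(1) by (simp add: prime_gt_0_nat)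
  have tot: "int (totient (p ^ Suc s)) = int p ^ s * (int p - 1)"
    using totient_prime_power_Suc[OF assms(1), of s] p by (simp add: of_nat_diff)
  have m: "int (p ^ Suc s) = int p ^ s * int p" by simp
  have "[euler_quotient (p ^ Suc s) (t + k * int (p ^ Suc s))
      = euler_quotient (p ^ Suc s) t + k * (int p ^ s * (int p - 1)) * P] (mod int p ^ s * int p)"
    using euler_quotient_shift[of t "p ^ Suc s" k] assms p
    unfolding coprime_prime_power_iff[OF assms(1)]
    by (simp only: P_def m[symmetric] tot[symmetric]) simp
  then have "[2 * euler_quotient (p ^ Suc s) (t + k * int (p ^ Suc s))
      = 2 * (euler_quotient (p ^ Suc s) t + k * (int p ^ s * (int p - 1)) * P)] (mod int p ^ s * int p)"
    by (rule cong_scalar_left)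
  moreover have "[2 * (int p - 1) * P = digit_step p s t] (mod int p)"
    by (simp add: digit_step_def P_def cong_def)
  then have "int p dvd 2 * (int p - 1) * P - digit_step p s t"
    by (simp add: cong_iff_dvd_diff)
  then have "int p ^ s * int p dvd int p ^ s * (k * (2 * (int p - 1) * P - digit_step p s t))"
    by (intro mult_dvd_mono) auto
  then have "[2 * (euler_quotient (p ^ Suc s) t + k * (int p ^ s * (int p - 1)) * P)
      = 2 * euler_quotient (p ^ Suc s) t + k * digit_step p s t * int p ^ s] (mod int p ^ s * int p)"
    by (simp add: cong_iff_dvd_diff algebra_simps)
  ultimately show ?thesis by (rule cong_trans)
qed

lemma leading_digit_shift:
  assumes "prime p" "\<not> int p dvd t"
  shows "leading_digit p s (t + k * int (p ^ Suc s))
    = (leading_digit p s t + k * digit_step p s t) mod int p"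
proof -
  define W where "W = 2 * euler_quotient (p ^ Suc s) t"
  define D where "D = digit_step p s t"
  have p: "p > 0" using assms(1) by (simp add: prime_gt_0_nat)
  have top: "X mod (int p ^ s * int p) div int p ^ s = X div int p ^ s mod int p" for X
    using p by (simp add: zmod_zmult2_eq)
  have "leading_digit p s (t + k * int (p ^ Suc s))
      = (W + k * D * int p ^ s) mod (int p ^ s * int p) div int p ^ s"
    using double_quotient_shift[OF assms, of s k]
    unfolding leading_digit_def cong_def W_def D_def by simp
  also have "\<dots> = (W div int p ^ s + k * D) mod int p"
    using p by (simp add: top add.commute)
  also have "\<dots> = (W div int p ^ s mod int p + k * D) mod int p"
    by (simp add: mod_simps)
  finally show ?thesis by (simp add: leading_digit_def top W_def D_def)
qed

text \<open>
  Reducing \<open>W + k d p^s\<close> modulo \<open>p^(s+1)\<close> subtracts an odd number once for each carry out of the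
  leading digit, and \<open>p^s\<close> is odd as well, so parities record the carries.
\<close>

lemma even_double_quotient_shift:
  assumes "prime p" "odd p" "\<not> int p dvd t"
  shows "even (2 * euler_quotient (p ^ Suc s) (t + k * int (p ^ Suc s)) mod (int p ^ s * int p))
    \<longleftrightarrow> even (2 * euler_quotient (p ^ Suc s) t mod (int p ^ s * int p) + k * digit_step p s t
          + (leading_digit p s t + k * digit_step p s t) div int p)"
proof -
  define W where "W = 2 * euler_quotient (p ^ Suc s) t mod (int p ^ s * int p)"
  define D where "D = digit_step p s t"
  define X where "X = W + k * D * int p ^ s"
  have p: "p > 0" using assms(1) by (simp add: prime_gt_0_nat)
  have "2 * euler_quotient (p ^ Suc s) (t + k * int (p ^ Suc s)) mod (int p ^ s * int p)
      = X mod (int p ^ s * int p)"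
    using double_quotient_shift[OF assms(1,3), of s k]
    unfolding cong_def X_def W_def D_def by (simp add: mod_simps)
  also have "\<dots> = X - int p ^ s * int p * (X div (int p ^ s * int p))"
    by (simp add: minus_mult_div_eq_mod)
  also have "X div (int p ^ s * int p) = X div int p ^ s div int p"
    by (simp add: zdiv_zmult2_eq)
  also have "X div int p ^ s = leading_digit p s t + k * D"
    using p by (simp add: X_def leading_digit_def W_def)
  finally show ?thesis
    using assms(2) by (simp add: X_def W_def D_def)
qed

text \<open>
  A shift by \<open>p^(s+2)\<close> is \<open>p\<close> shifts by the modulus \<open>m = p^(s+1)\<close>, and \<open>p \<phi>(m)\<close> is divisible by \<open>m\<close>.
  This makes the reduction of the index in the definition of the sequence harmless.
\<close>

lemma euler_quotient_periodic:
  assumes "prime p"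
  shows "euler_quotient (p ^ Suc s) (t + k * int (p ^ (Suc s + 1))) = euler_quotient (p ^ Suc s) t"
proof (cases "int p dvd t")
  case True
  then have "int p dvd t + k * int (p ^ (Suc s + 1))" by simp
  then show ?thesis
    using True by (simp only: euler_quotient_def coprime_prime_power_iff[OF assms]) simp
next
  case False
  have p: "p > 0" using assms(1) by (simp add: prime_gt_0_nat)
  define m where "m = p ^ Suc s"
  have m: "m > 0" using p by (simp add: m_def)
  have "int (totient m) * int p = int m * (int p - 1)"
    using totient_prime_power_Suc[OF assms(1), of s] p by (simp add: m_def of_nat_diff)
  then have "int m dvd k * int p * int (totient m) * t ^ (totient m - 1)"
    by (metis dvd_mult dvd_mult2 dvd_triv_left mult.assoc mult.commute)
  then have "[euler_quotient m t + k * int p * int (totient m) * t ^ (totient m - 1)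
      = euler_quotient m t] (mod int m)"
    by (simp add: cong_iff_dvd_diff)
  moreover have "[euler_quotient m (t + k * int p * int m)
      = euler_quotient m t + k * int p * int (totient m) * t ^ (totient m - 1)] (mod int m)"
    using False m coprime_prime_power_iff[OF assms, of t s]
    by (intro euler_quotient_shift) (simp_all add: m_def del: of_nat_power)
  ultimately have "[euler_quotient m (t + k * int p * int m) = euler_quotient m t] (mod int m)"
    using cong_trans by blast
  then have "euler_quotient m (t + k * int p * int m) = euler_quotient m t"
    using m by (simp add: cong_def euler_quotient_range)
  then show ?thesis by (simp add: m_def mult.assoc)
qed

text \<open>
  For an odd modulus \<open>m\<close> and \<open>0 \<le> q < m\<close>, doubling \<open>q\<close> modulo \<open>m\<close> gives \<open>2 q\<close> or \<open>2 q - m\<close>, and the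
  odd value occurs precisely in the upper half. Parity replaces the order condition because it is
  compatible with adding multiples of \<open>p^s\<close>.
\<close>

lemma even_euler_binary_seq_iff:
  assumes "prime p" "odd p"
  shows "even (euler_binary_seq p (Suc s) t)
    \<longleftrightarrow> even (2 * euler_quotient (p ^ Suc s) (int t) mod (int p ^ s * int p))"
proof -
  define m where "m = int p ^ s * int p"
  define q where "q = euler_quotient (p ^ Suc s) (int t)"
  have p: "p > 0" using assms(1) by (simp add: prime_gt_0_nat)
  have m: "int (p ^ Suc s) = m" "m > 0" "odd m" using p assms by (simp_all add: m_def)
  have q: "0 \<le> q" "q < m"
    using euler_quotient_range[of "p ^ Suc s" "int t"] p m(1) by (simp_all add: q_def)
  define M where "M = p ^ (Suc s + 1)"
  have "int t = int (t mod M) + int (t div M) * int M"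
    by (metis of_nat_add of_nat_mult mod_div_mult_eq)
  then have "euler_quotient (p ^ Suc s) (int (t mod M)) = q"
    using euler_quotient_periodic[OF assms(1), of s "int (t mod M)" "int (t div M)"]
    by (simp add: q_def M_def del: of_nat_power)
  moreover have "real (p ^ Suc s) = real_of_int m"
    using m(1) by (metis of_int_of_nat_eq)
  ultimately have "even (euler_binary_seq p (Suc s) t) \<longleftrightarrow> 0 \<le> real_of_int q / real_of_int m
      \<and> real_of_int q / real_of_int m < 1 / 2"
    unfolding euler_binary_seq_def Let_def M_def by simp
  also have "\<dots> \<longleftrightarrow> 2 * q < m"
    using q m(2) by (simp add: divide_simps) linarith
  also have "\<dots> \<longleftrightarrow> even (2 * q mod m)"
  proof (cases "2 * q < m")
    case True
    then show ?thesis using q by simp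
  next
    case False
    then have "2 * q mod m = 2 * q - m"
      using q m(2) by (intro mod_pos_pos_trivial[of "2 * q - m" m, simplified]) auto
    then show ?thesis using False m(3) by simp
  qed
  finally show ?thesis by (simp add: q_def m_def)
qed

definition shift_pattern_sign :: "nat \<Rightarrow> nat \<Rightarrow> nat \<Rightarrow> int" where
  "shift_pattern_sign p \<tau> t = (-1) ^ (euler_binary_seq p \<tau> t + euler_binary_seq p \<tau> (t + p ^ \<tau>)
     + euler_binary_seq p \<tau> (t + 2 * p ^ \<tau>) + euler_binary_seq p \<tau> (t + 3 * p ^ \<tau>))"

text \<open>
  The four parities are \<open>W + k d + (w + k d) div p\<close> for \<open>k = 0, 1, 2, 3\<close>. Their sum has
  \<open>4 W + 6 d\<close> in it, which is even, and for \<open>k = 0\<close> there is no carry. The evenness of 4 removes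
  every digit but the leading one, and that of \<open>0 + 1 + 2 + 3\<close> removes the step.
\<close>

lemma shift_pattern_sign_eq_carry_sign:
  assumes "prime p" "odd p" "\<not> p dvd t"
  shows "shift_pattern_sign p (Suc s) t
    = carry_sign (int p) (leading_digit p s (int t)) (digit_step p s (int t))"
proof -
  define W where "W = 2 * euler_quotient (p ^ Suc s) (int t) mod (int p ^ s * int p)"
  define D where "D = digit_step p s (int t)"
  define w where "w = leading_digit p s (int t)"
  have p: "p > 0" using assms(1) by (simp add: prime_gt_0_nat)
  have ndvd: "\<not> int p dvd int t" using assms(3) by simp
  have "even (euler_binary_seq p (Suc s) (t + k * p ^ Suc s))
      \<longleftrightarrow> even (W + int k * D + (w + int k * D) div int p)" for k
    using even_euler_binary_seq_iff[OF assms(1,2), of s "t + k * p ^ Suc s"]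
      even_double_quotient_shift[OF assms(1,2) ndvd, of s "int k"]
    by (simp add: W_def D_def w_def)
  from this[of 0] this[of 1] this[of 2] this[of 3]
  have "even (euler_binary_seq p (Suc s) t) \<longleftrightarrow> even (W + w div int p)"
    "even (euler_binary_seq p (Suc s) (t + p ^ Suc s)) \<longleftrightarrow> even (W + D + (w + D) div int p)"
    "even (euler_binary_seq p (Suc s) (t + 2 * p ^ Suc s))
       \<longleftrightarrow> even (W + 2 * D + (w + 2 * D) div int p)"
    "even (euler_binary_seq p (Suc s) (t + 3 * p ^ Suc s))
       \<longleftrightarrow> even (W + 3 * D + (w + 3 * D) div int p)"
    by simp_all
  moreover have "w div int p = 0"
    using p by (simp add: w_def leading_digit_def zmod_zmult2_eq)
  ultimately show ?thesis
    unfolding shift_pattern_sign_def carry_sign_def minus_one_power_iff D_def[symmetric] w_def[symmetric]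
    by (simp del: power_Suc) blast
qed

lemma shift_pattern_sign_eq_1:
  assumes "prime p" "p dvd t"
  shows "shift_pattern_sign p (Suc s) t = 1"
proof -
  have "euler_binary_seq p (Suc s) u = 0" if "p dvd u" for u
  proof -
    have "p dvd u mod p ^ (Suc s + 1)" using that by (simp add: dvd_mod)
    then have "int p dvd int (u mod p ^ (Suc s + 1))" using int_dvd_int_iff by blast
    then have "\<not> coprime (int (u mod p ^ (Suc s + 1))) (int (p ^ Suc s))"
      unfolding coprime_prime_power_iff[OF assms(1)] by simp
    then show ?thesis unfolding euler_binary_seq_def euler_quotient_def by simp
  qed
  then show ?thesis using assms(2) by (simp add: shift_pattern_sign_def)
qed

section \<open>Equidistribution of the leading digit and of the step\<close>

lemma bij_betw_residuesI:
  assumes "\<And>x. x < p \<Longrightarrow> 0 \<le> f x \<and> f x < int p"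
    and "\<And>x y. x < p \<Longrightarrow> y < p \<Longrightarrow> f x = f y \<Longrightarrow> [int x = int y] (mod int p)"
  shows "bij_betw f {..<p} {0..<int p}"
proof -
  have inj: "inj_on f {..<p}"
    using assms(2) by (intro inj_onI) (auto simp: cong_def)
  moreover have "f ` {..<p} = {0..<int p}"
    using assms(1) inj by (intro card_subset_eq) (auto simp: card_image)
  ultimately show ?thesis by (simp add: bij_betw_def)
qed

lemma bij_betw_affine_residues:
  assumes "prime p" "\<not> int p dvd d"
  shows "bij_betw (\<lambda>v. (w + int v * d) mod int p) {..<p} {0..<int p}"
proof (rule bij_betw_residuesI)
  fix x y :: nat
  assume "(w + int x * d) mod int p = (w + int y * d) mod int p"
  then have "int p dvd (int x - int y) * d"
    by (simp add: mod_eq_dvd_iff algebra_simps)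
  then show "[int x = int y] (mod int p)"
    using assms by (simp add: prime_dvd_mult_iff cong_iff_dvd_diff)
qed (use assms prime_gt_0_nat in auto)

lemma digit_step_times:
  assumes "prime p" "\<not> int p dvd t"
  shows "[t * digit_step p s t = 2 * (int p - 1)] (mod int p)"
proof -
  define m where "m = p ^ Suc s"
  have m: "m > 0" using assms(1) by (simp add: m_def prime_gt_0_nat)
  have "int m dvd t ^ totient m - 1"
    using assms m coprime_prime_power_iff[OF assms(1), of t s]
    by (intro euler_quotient_dvd) (simp_all add: m_def del: of_nat_power)
  moreover have "int p dvd int m" by (simp add: m_def)
  ultimately have "[t ^ totient m = 1] (mod int p)"
    by (metis cong_iff_dvd_diff dvd_trans)
  then have "[2 * (int p - 1) * t ^ totient m = 2 * (int p - 1) * 1] (mod int p)"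
    by (rule cong_scalar_left)
  moreover have "[t * digit_step p s t = t * (2 * (int p - 1) * t ^ (totient m - 1))] (mod int p)"
    by (simp add: digit_step_def m_def cong_def mod_simps)
  moreover have "t * (2 * (int p - 1) * t ^ (totient m - 1)) = 2 * (int p - 1) * t ^ totient m"
    using m by (metis (no_types, lifting) mult.left_commute power_eq_if totient_gt_0_iff less_irrefl)
  ultimately show ?thesis by (metis cong_trans mult.right_neutral)
qed

lemma not_dvd_double_pred:
  assumes "prime p" "odd p"
  shows "\<not> int p dvd 2 * (int p - 1)"
proof
  assume "int p dvd 2 * (int p - 1)"
  then have "int p dvd 2 * int p - 2 * (int p - 1)" by (intro dvd_diff) auto
  then have "int p dvd int 2" by simp
  then have "p dvd 2" by (simp only: int_dvd_int_iff)
  then show False using assms by (metis dvd_refl primes_dvd_imp_eq two_is_prime_nat)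
qed

lemma digit_step_eq_0:
  assumes "prime p" "odd p" "int p dvd t"
  shows "digit_step p s t = 0"
proof -
  have "p \<noteq> 2" using assms(2) by auto
  then have "1 * 1 < p ^ s * (p - 1)"
    using prime_ge_2_nat[OF assms(1)] by (intro mult_le_less_imp_less) auto
  then have "totient (p ^ Suc s) > 1"
    by (simp only: totient_prime_power_Suc[OF assms(1)])
  then have "int p dvd t ^ (totient (p ^ Suc s) - 1)"
    using assms(3) by (intro dvd_trans[OF assms(3) dvd_power]) simp
  then show ?thesis by (simp add: digit_step_def)
qed

lemma digit_step_cong:
  assumes "[t = u] (mod int p)"
  shows "digit_step p s t = digit_step p s u"
  using assms unfolding digit_step_def cong_def
  by (metis cong_def cong_pow cong_scalar_left)

text \<open>
  Inversion modulo \<open>p\<close> followed by multiplication with the unit \<open>-2\<close>, extended by \<open>0 \<mapsto> 0\<close>, is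
  injective.
\<close>

lemma bij_betw_digit_step:
  assumes "prime p" "odd p"
  shows "bij_betw (\<lambda>a. digit_step p s (int a)) {..<p} {0..<int p}"
proof (rule bij_betw_residuesI)
  fix x y :: nat
  define E where "E = 2 * (int p - 1)"
  assume eq: "digit_step p s (int x) = digit_step p s (int y)"
  have E: "\<not> int p dvd E" using not_dvd_double_pred[OF assms] by (simp add: E_def)
  have nz: "digit_step p s t = 0 \<longleftrightarrow> int p dvd t" for t
  proof
    assume "digit_step p s t = 0"
    then have "\<not> int p dvd t \<Longrightarrow> [0 = E] (mod int p)"
      using digit_step_times[OF assms(1), of t s] by (simp add: E_def)
    then show "int p dvd t" using E by (metis cong_dvd_iff dvd_0_right)
  qed (rule digit_step_eq_0[OF assms])
  show "[int x = int y] (mod int p)"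
  proof (cases "int p dvd int x")
    case True
    then have "int p dvd int y" using nz eq by metis
    then show ?thesis using True by (simp add: cong_iff_dvd_diff)
  next
    case False
    then have y: "\<not> int p dvd int y" using nz eq by metis
    define D where "D = digit_step p s (int x)"
    have "[int x * D = E] (mod int p)" "[int y * D = E] (mod int p)"
      using digit_step_times[OF assms(1), of "int x" s] digit_step_times[OF assms(1), of "int y" s]
        False y eq by (simp_all add: D_def E_def)
    then have "[int x * D = int y * D] (mod int p)"
      using cong_trans cong_sym by blast
    then have "int p dvd (int x - int y) * D"
      by (simp add: cong_iff_dvd_diff algebra_simps)
    moreover have "\<not> int p dvd D"
      using \<open>[int x * D = E] (mod int p)\<close> E by (metis cong_dvd_iff dvd_mult)
    ultimately show ?thesis
      using assms(1) by (simp add: prime_dvd_mult_iff cong_iff_dvd_diff)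
  qed
qed (use assms prime_gt_0_nat in \<open>auto simp: digit_step_def\<close>)

text \<open>
  The sum over an initial segment is grouped by residue modulo \<open>b\<close>. It is used with \<open>b = p^(s+1)\<close>,
  where the inner sum moves the leading digit, and with \<open>b = p\<close>, where the inner sum is constant.
\<close>

lemma sum_lessThan_mult:
  fixes f :: "nat \<Rightarrow> 'a::comm_monoid_add"
  shows "sum f {..<a * b} = (\<Sum>i<b. \<Sum>j<a. f (i + j * b))"
proof -
  have "sum f {..<a * b} = (\<Sum>j<a. sum f {0 + j * b..<b + j * b})"
    by (simp only: sum.nat_group [symmetric]) (simp add: add.commute)
  also have "\<dots> = (\<Sum>j<a. \<Sum>i<b. f (i + j * b))"
    by (simp only: sum.shift_bounds_nat_ivl atLeast0LessThan)
  finally show ?thesis by (subst sum.swap)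
qed

text \<open>
  Along a coset of the modulus the step does not change and the leading digit runs through an
  arithmetic progression with difference the step, hence through all residues modulo \<open>p\<close>. If \<open>p\<close>
  divides \<open>u\<close>, both sides equal \<open>p\<close>.
\<close>

lemma sum_shift_pattern_sign_coset:
  assumes "prime p" "odd p"
  shows "(\<Sum>v<p. shift_pattern_sign p (Suc s) (u + v * p ^ Suc s))
    = (\<Sum>w\<in>{0..<int p}. carry_sign (int p) w (digit_step p s (int u)))"
proof (cases "p dvd u")
  case True
  then have "(\<Sum>v<p. shift_pattern_sign p (Suc s) (u + v * p ^ Suc s)) = (\<Sum>v<p. 1)"
    using assms(1) by (intro sum.cong refl shift_pattern_sign_eq_1) auto
  also have "\<dots> = (\<Sum>w\<in>{0..<int p}. carry_sign (int p) w 0)"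
    using prime_gt_0_nat[OF assms(1)] by (subst sum_carry_sign_row) auto
  finally show ?thesis using True digit_step_eq_0[OF assms, of "int u" s] by simp
next
  case False
  define D where "D = digit_step p s (int u)"
  define w where "w = leading_digit p s (int u)"
  have ndvd: "\<not> int p dvd int u" using False by simp
  have "\<not> int p dvd D"
    using digit_step_times[OF assms(1) ndvd, of s] not_dvd_double_pred[OF assms]
    by (metis D_def cong_dvd_iff dvd_mult)
  have "shift_pattern_sign p (Suc s) (u + v * p ^ Suc s)
      = carry_sign (int p) ((w + int v * D) mod int p) D" for v
  proof -
    have int_eq: "int (u + v * p ^ Suc s) = int u + int v * int (p ^ Suc s)" by simp
    have "[int u + int v * int (p ^ Suc s) = int u] (mod int p)"
      by (simp add: cong_iff_dvd_diff)
    then have "digit_step p s (int (u + v * p ^ Suc s)) = D"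
      unfolding int_eq D_def by (rule digit_step_cong)
    moreover have "leading_digit p s (int (u + v * p ^ Suc s)) = (w + int v * D) mod int p"
      unfolding int_eq D_def w_def by (rule leading_digit_shift[OF assms(1) ndvd])
    moreover have "\<not> p dvd u + v * p ^ Suc s"
      using False by (simp add: dvd_add_left_iff)
    ultimately show ?thesis
      using shift_pattern_sign_eq_carry_sign[OF assms] by simp
  qed
  then have "(\<Sum>v<p. shift_pattern_sign p (Suc s) (u + v * p ^ Suc s))
      = (\<Sum>v<p. carry_sign (int p) ((w + int v * D) mod int p) D)" by simp
  also have "\<dots> = (\<Sum>w\<in>{0..<int p}. carry_sign (int p) w D)"
    by (rule sum.reindex_bij_betw[OF bij_betw_affine_residues[OF assms(1) \<open>\<not> int p dvd D\<close>]])
  finally show ?thesis by (simp add: D_def)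
qed

text \<open>
  The coset sums depend on \<open>u\<close> only through its step, thus only through \<open>u\<close> modulo \<open>p\<close>, and every
  step comes from exactly one residue \<open>a\<close>. The factor \<open>p^s\<close> counts the \<open>u < p^(s+1)\<close> that are
  congruent to a given \<open>a\<close>.
\<close>

lemma sum_shift_pattern_sign:
  assumes "prime p" "odd p"
  shows "3 * (\<Sum>t<p ^ (Suc s + 1). shift_pattern_sign p (Suc s) t)
    = int p ^ s * (int p ^ 2 + (if 3 dvd p then -6 else 2))"
proof -
  define R where "R d = (\<Sum>w\<in>{0..<int p}. carry_sign (int p) w d)" for d
  have "(\<Sum>t<p ^ (Suc s + 1). shift_pattern_sign p (Suc s) t)
      = (\<Sum>u<p ^ s * p. R (digit_step p s (int u)))"
    using sum_lessThan_mult[of "shift_pattern_sign p (Suc s)" p "p ^ Suc s"]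
    by (simp only: sum_shift_pattern_sign_coset[OF assms] R_def) (simp add: mult.commute)
  also have "\<dots> = (\<Sum>a<p. \<Sum>b<p ^ s. R (digit_step p s (int (a + b * p))))"
    by (rule sum_lessThan_mult)
  also have "\<dots> = (\<Sum>a<p. \<Sum>b<p ^ s. R (digit_step p s (int a)))"
    by (intro sum.cong refl arg_cong[of _ _ R] digit_step_cong) (simp add: cong_iff_dvd_diff)
  also have "\<dots> = int p ^ s * (\<Sum>a<p. R (digit_step p s (int a)))"
    by (simp add: sum_distrib_left)
  also have "(\<Sum>a<p. R (digit_step p s (int a))) = (\<Sum>d\<in>{0..<int p}. R d)"
    by (rule sum.reindex_bij_betw[OF bij_betw_digit_step[OF assms]])
  finally have "3 * (\<Sum>t<p ^ (Suc s + 1). shift_pattern_sign p (Suc s) t)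
      = int p ^ s * (3 * (\<Sum>d\<in>{0..<int p}. R d))"
    by simp
  then show ?thesis
    unfolding R_def sum_carry_sign_square[OF assms(2)] .
qed

lemma one_le_ln_of_ge_3:
  assumes "x \<ge> (3 :: real)"
  shows "1 \<le> ln x"
proof -
  have "exp 1 \<le> x" using exp_le assms by linarith
  then show ?thesis using assms by (subst ln_ge_iff) auto
qed

theorem corollary1:
  shows "\<exists>C::real. \<forall>p \<tau> :: nat. prime p \<and> p > 2 \<and> \<tau> \<ge> 1 \<longrightarrow>
    \<bar>(\<Sum>t = 0..p ^ (\<tau> + 1) - 1.
        (-1 :: real) ^ (euler_binary_seq p \<tau> t + euler_binary_seq p \<tau> (t + p ^ \<tau>)
          + euler_binary_seq p \<tau> (t + 2 * p ^ \<tau>) + euler_binary_seq p \<tau> (t + 3 * p ^ \<tau>)))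
      - 1 / 3 * real p ^ (\<tau> + 1)\<bar>
    \<le> C * (real p powr (real \<tau> + 1 / 2) * (ln (real p ^ \<tau>)) ^ 4)"
  \<comment> \<open>The exact value differs from the main term by \<open>p^(\<tau>-1) * c / 3\<close> with \<open>c = 2\<close> or \<open>c = -6\<close>; the
      factor \<open>ln (p^\<tau>) ^ 4\<close> is at least 1 because \<open>p^\<tau> \<ge> 3 > exp 1\<close>.\<close>
proof (intro exI[of _ 2] allI impI)
  fix p \<tau> :: nat
  assume asm: "prime p \<and> p > 2 \<and> \<tau> \<ge> 1"
  then obtain s where \<tau>: "\<tau> = Suc s" by (cases \<tau>) auto
  have p: "prime p" "odd p" "real p \<ge> 3" using asm prime_odd_nat by auto
  define S where "S = (\<Sum>t = 0..p ^ (\<tau> + 1) - 1.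
        (-1 :: real) ^ (euler_binary_seq p \<tau> t + euler_binary_seq p \<tau> (t + p ^ \<tau>)
          + euler_binary_seq p \<tau> (t + 2 * p ^ \<tau>) + euler_binary_seq p \<tau> (t + 3 * p ^ \<tau>)))"
  define c :: int where "c = (if 3 dvd p then -6 else 2)"
  have "p ^ (\<tau> + 1) > 0" using asm by simp
  then have "{0..p ^ (\<tau> + 1) - 1} = {..<p ^ (\<tau> + 1)}"
    by (metis Suc_diff_1 atLeast0AtMost lessThan_Suc_atMost)
  then have "S = of_int (\<Sum>t<p ^ (Suc s + 1). shift_pattern_sign p (Suc s) t)"
    by (simp add: S_def shift_pattern_sign_def \<tau>)
  then have "3 * S = of_int (3 * (\<Sum>t<p ^ (Suc s + 1). shift_pattern_sign p (Suc s) t))"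
    by simp
  also have "\<dots> = real p ^ s * (real p ^ 2 + of_int c)"
    unfolding sum_shift_pattern_sign[OF p(1,2)] c_def by simp
  finally have error: "S - 1 / 3 * real p ^ (\<tau> + 1) = real p ^ s * (of_int c / 3)"
    by (simp add: \<tau> field_simps power2_eq_square)
  have "\<bar>S - 1 / 3 * real p ^ (\<tau> + 1)\<bar> \<le> 2 * real p ^ s"
    unfolding error abs_mult by (simp add: c_def)
  also have "real p ^ s = real p powr real s"
    using p by (simp add: powr_realpow)
  also have "2 * real p powr real s \<le> 2 * (real p powr (real \<tau> + 1 / 2) * (ln (real p ^ \<tau>)) ^ 4)"
  proof -
    have "real p powr real s \<le> real p powr (real \<tau> + 1 / 2)"
      using p by (intro powr_mono) (auto simp: \<tau>)
    moreover have "real p ^ 1 \<le> real p ^ \<tau>"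
      using p asm by (intro power_increasing) auto
    then have "3 \<le> real p ^ \<tau>" using p(3) by (metis order_trans power_one_right)
    then have "1 \<le> ln (real p ^ \<tau>)" by (rule one_le_ln_of_ge_3)
    then have "1 \<le> (ln (real p ^ \<tau>)) ^ 4" by (rule one_le_power)
    ultimately have "real p powr real s * 1 \<le> real p powr (real \<tau> + 1 / 2) * (ln (real p ^ \<tau>)) ^ 4"
      by (intro mult_mono) auto
    then show ?thesis by simp
  qed
  finally show "\<bar>S - 1 / 3 * real p ^ (\<tau> + 1)\<bar>
      \<le> 2 * (real p powr (real \<tau> + 1 / 2) * (ln (real p ^ \<tau>)) ^ 4)" .
qed

end
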